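(* Let $r>0$ be an integer and let $g$ be an integer. The supermoduli space $\mathfrak{M}_{g,0,2r}$ is realizable if and only if $g\ge 5r+1\ge 6$.
   Context: $\mathfrak{M}_{g,0,2r}$ is the moduli space (over $\mathbb{C}$) of genus $g$ super Riemann surfaces with no Neveu-Schwarz punctures and $2r$ Ramond punctures. Consider degree $d$ branched covers $\tilde X\to X$ of genus $2$ super Riemann surfaces, with a single branch point, over which the fiber has ramification configuration $\rho=(d_1,\dots,d_s)$, $d_i\ge 1$, $\sum_i d_i=d$ (here $d_i$ is the number of sheets coming together at the $i$-th point of the fiber). The genus of $\tilde X$ is given by the Hurwitz formula $$g=1+d+\tfrac12\sum_{i=1}^s(d_i-1)=1+\tfrac32 d-\tfrac12 s .\qquad( * )$$ The points of the fiber with even local degree $d_i$ are exactly those that become Ramond punctures of $\tilde X$; hence $2r$ is the number of indices $i$ with $d_i$ even (this number is automatically even when $( * )$ is an integer). For fixed $r>0$, $\mathfrak{M}_{g,0,2r}$ is called realizable if $g$ is a solution of $( * )$ for some $d$ and some $\rho=(d_1,\dots,d_s)$ with $\sum_i d_i=d$ and exactly $2r$ even entries. Equivalently, $\mathfrak{M}_{g,0,2r}$ contains the image of the moduli space of such branched covers of degree $d$ and ramification configuration $\rho$ under $(\tilde X\to X)\mapsto\tilde X$ (forgetting NS punctures). *)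

theory Defs
  imports Complex_Main
begin

definition ramification_configuration :: "nat \<Rightarrow> nat list \<Rightarrow> bool" where
  "ramification_configuration d \<rho> \<longleftrightarrow> (\<forall>k\<in>set \<rho>. 1 \<le> k) \<and> sum_list \<rho> = d"

text \<open>
  Riemann--Hurwitz for a degree \<open>d\<close> cover of a genus 2 surface with one branch point:
  \<open>2 g - 2 = d (2 \<cdot> 2 - 2) + (\<Sum>i. d\<^sub>i - 1)\<close>. The value is rational, as it is
  a half-integer for configurations with an odd number of even entries.
\<close>

definition hurwitz_genus :: "nat \<Rightarrow> nat list \<Rightarrow> rat" where
  "hurwitz_genus d \<rho> =
     1 + of_nat d + 1 / 2 * (\<Sum>i<length \<rho>. (of_nat (\<rho> ! i) - 1))"

text \<open>
  The points of the fibre with even local degree are the ones that become Ramond punctures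
  of the covering super Riemann surface.
\<close>

definition ramond_punctures :: "nat list \<Rightarrow> nat" where
  "ramond_punctures \<rho> = card {i. i < length \<rho> \<and> even (\<rho> ! i)}"

text \<open>
  \<open>realizable g n\<close> is realizability of the moduli space of genus \<open>g\<close> super Riemann surfaces
  with no Neveu-Schwarz punctures and \<open>n\<close> Ramond punctures (so \<open>n = 2 r\<close> in
  \<open>\<MM>\<^bsub>g,0,2r\<^esub>\<close>).
\<close>

definition realizable :: "int \<Rightarrow> nat \<Rightarrow> bool" where
  "realizable g n \<longleftrightarrow>
     (\<exists>d \<rho>. ramification_configuration d \<rho> \<and> ramond_punctures \<rho> = n \<and>
            of_int g = hurwitz_genus d \<rho>)"

lemma hurwitz_genus_eq:
  assumes "ramification_configuration d \<rho>"
  shows "hurwitz_genus d \<rho> = 1 + 3 / 2 * of_nat d - 1 / 2 * of_nat (length \<rho>)"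
proof -
  have "of_nat d = (\<Sum>i<length \<rho>. of_nat (\<rho> ! i) :: rat)"
    using assms by (auto simp: ramification_configuration_def sum_list_sum_nth atLeast0LessThan)
  then show ?thesis
    by (simp add: hurwitz_genus_def sum_subtractf field_simps)
qed

end

theory Submission
  imports Defs
begin

text \<open>
  A point of local degree \<open>k\<close> contributes \<open>(3 k - 1) / 2\<close> to \<open>g - 1\<close>. This is at least
  \<open>5 / 2\<close> for even \<open>k\<close>, with equality for \<open>k = 2\<close>, and equals \<open>1\<close> for \<open>k = 1\<close>; so the
  genera above the minimum are reached from \<open>2 r\<close> points of degree 2 by adding unramified points.
\<close>

lemma ramond_punctures_eq_length_filter:
  "ramond_punctures \<rho> = length (filter even \<rho>)"
  by (simp add: ramond_punctures_def length_filter_conv_card)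

text \<open>Clearing denominators makes the genus condition a linear equation over the
  integers.\<close>

lemma eq_hurwitz_genus_iff:
  assumes "ramification_configuration d \<rho>"
  shows "of_int g = hurwitz_genus d \<rho> \<longleftrightarrow> 2 * g + int (length \<rho>) = 2 + 3 * int d"
proof -
  have "of_int g = hurwitz_genus d \<rho> \<longleftrightarrow>
      (of_int (2 * g + int (length \<rho>)) :: rat) = of_int (2 + 3 * int d)"
    by (auto simp: hurwitz_genus_eq[OF assms] field_simps)
  then show ?thesis
    by (simp only: of_int_eq_iff)
qed

text \<open>Sum over the entries: \<open>3 * k - 1\<close> is at least 5 for even \<open>k\<close>,
  and for odd \<open>k\<close> nonnegativity suffices.\<close>

lemma length_plus_even_entries_le:
  fixes \<rho> :: "nat list"
  assumes "\<forall>k\<in>set \<rho>. 1 \<le> k"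
  shows "length \<rho> + 5 * length (filter even \<rho>) \<le> 3 * sum_list \<rho>"
  using assms
proof (induction \<rho>)
  case (Cons k \<rho>)
  then have "even k \<Longrightarrow> 2 \<le> k"
    by (auto elim!: evenE)
  with Cons show ?case
    by auto
qed simp

theorem lemma2:
  fixes r :: nat and g :: int
  assumes "r > 0"
  shows "realizable g (2 * r) \<longleftrightarrow> g \<ge> 5 * int r + 1 \<and> 5 * int r + 1 \<ge> 6"
proof
  assume "realizable g (2 * r)"
  then obtain d \<rho> where \<rho>: "ramification_configuration d \<rho>"
    and "length (filter even \<rho>) = 2 * r" and "2 * g + int (length \<rho>) = 2 + 3 * int d"
    by (auto simp: realizable_def eq_hurwitz_genus_iff ramond_punctures_eq_length_filter)
  moreover have "length \<rho> + 5 * length (filter even \<rho>) \<le> 3 * d"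
    using \<rho> length_plus_even_entries_le by (auto simp: ramification_configuration_def)
  \<comment> \<open>Together these give
    \<open>2 * g - 2 = 3 * d - length \<rho> \<ge> 10 * r\<close>.\<close>
  ultimately show "g \<ge> 5 * int r + 1 \<and> 5 * int r + 1 \<ge> 6"
    using assms by linarith
next
  assume "g \<ge> 5 * int r + 1 \<and> 5 * int r + 1 \<ge> 6"
  then obtain m where g: "g = 5 * int r + 1 + int m"
    using zle_iff_zadd by blast
  define \<rho> where "\<rho> = replicate (2 * r) 2 @ replicate m (1 :: nat)"
  have config: "ramification_configuration (4 * r + m) \<rho>"
    by (auto simp: ramification_configuration_def \<rho>_def sum_list_replicate)
  moreover have "ramond_punctures \<rho> = 2 * r"
    by (simp add: ramond_punctures_eq_length_filter \<rho>_def)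
  \<comment> \<open>Here \<open>3 * (4 * r + m) - (2 * r + m) = 10 * r + 2 * m\<close>, which is
    twice \<open>g - 1\<close>.\<close>
  moreover have "of_int g = hurwitz_genus (4 * r + m) \<rho>"
    unfolding eq_hurwitz_genus_iff[OF config] by (simp add: g \<rho>_def)
  ultimately show "realizable g (2 * r)"
    unfolding realizable_def by blast
qed

end
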